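(* Let $n$, $k$, $t$, and $s$ be positive integers such that $\max(t+1,s)\le k\le n$. (a) If $2\max(t,s)\le k$, then $M(n,2,k,t,s) = \binom{n}{s}$. That is, in every $2$-edge-coloring of $K^k_n$, there is a monochromatic $t$-tight component $C$ (i.e. a $t$-tight component of the hypergraph of edges of one of the colors) such that $E^{(s)}(C)=E^{(s)}(K_n^k)$. (b) If $3\max(t,s)\le 2k$, then there is a $2$-edge-coloring $\mathbf{c}$ of $K^k_n$ attaining $$M(n,2,k,t,s;\mathbf{c}) = M(n,2,k,t,s),$$ and such that, for each of the two colors, all edges of that color (if there are any) are contained in a single $t$-tight component of that color.
   Context: $K_n^k$ denotes the complete $k$-uniform hypergraph on a vertex set $V_n$ of size $n$, where $n\ge k\ge 2$ (its edges are all $k$-subsets of $V_n$). Hypergraphs are identified with their edge sets. For a hypergraph or edge set $H$ and a positive integer $s$, the $s$-shadow is $E^{(s)}(H)=\{S : |S|=s,\ \exists e\in H: S\subseteq e\}$. For a hypergraph $H$, the $t$-tight components of $H$ are the classes of the partition of the edges of $H$ obtained by starting from singletons (one per edge) and iteratively merging two classes whenever one contains an edge $e$ and the other an edge $f$ with $|e\cap f|\ge t$, until no further merging is possible; $TC_t(H)$ is the family of these edge sets. $\mathrm{Col}_r(H)$ is the family of all (not necessarily proper) colorings of the edges of $H$ with colors $1,\dots,r$ (not all colors need be used). For $\mathbf{c}\in \mathrm{Col}_r(K_n^k)$ let $H_i=H_i(\mathbf{c})$ be the $k$-uniform hypergraph of all edges of color $i$, and define $$M(n,r,k,t,s;\mathbf{c})=\max_{i\in\{1,\dots,r\}}\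 \max_{C\in TC_t(H_i)}|E^{(s)}(C)|$$ (color classes with no edges are ignored), and $M(n,r,k,t,s)=\min_{\mathbf{c}\in \mathrm{Col}_r(K_n^k)} M(n,r,k,t,s;\mathbf{c})$. *)

theory Defs
  imports "HOL-Library.Ramsey"
begin

text \<open>A hypergraph is identified with its set of edges. The complete \<open>k\<close>-uniform hypergraph on a
  vertex set \<open>V\<close> is \<open>nsets V k\<close>.\<close>

definition shadow :: "nat \<Rightarrow> 'a set set \<Rightarrow> 'a set set" where
  "shadow s H = {S. card S = s \<and> (\<exists>e\<in>H. S \<subseteq> e)}"

definition merge_step :: "nat \<Rightarrow> 'a set set set \<Rightarrow> 'a set set set \<Rightarrow> bool" where
  "merge_step t P Q \<longleftrightarrow>
     (\<exists>C\<in>P. \<exists>D\<in>P. C \<noteq> D \<and> (\<exists>e\<in>C. \<exists>f\<in>D. t \<le> card (e \<inter> f)) \<and> Q = insert (C \<union> D) (P - {C, D}))"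

text \<open>The final partition does not depend on the order of the merging steps when \<open>H\<close> is finite, so the
  definite description is well defined: see \<open>tight_components_unique\<close> below.\<close>

definition tight_components :: "nat \<Rightarrow> 'a set set \<Rightarrow> 'a set set set" where
  "tight_components t H =
     (THE P. (merge_step t)\<^sup>*\<^sup>* ((\<lambda>e. {e}) ` H) P \<and> (\<nexists>Q. merge_step t P Q))"

definition colorings :: "nat \<Rightarrow> 'a set set \<Rightarrow> ('a set \<Rightarrow> nat) set" where
  "colorings r H = H \<rightarrow>\<^sub>E {1..r}"

definition color_class :: "'a set \<Rightarrow> nat \<Rightarrow> ('a set \<Rightarrow> nat) \<Rightarrow> nat \<Rightarrow> 'a set set" where
  "color_class V k c i = {e \<in> nsets V k. c e = i}"

definition M_col :: "'a set \<Rightarrow> nat \<Rightarrow> nat \<Rightarrow> nat \<Rightarrow> nat \<Rightarrow> ('a set \<Rightarrow> nat) \<Rightarrow> nat" where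
  "M_col V r k t s c =
     (MAX i\<in>{i \<in> {1..r}. color_class V k c i \<noteq> {}}.
        MAX C\<in>tight_components t (color_class V k c i). card (shadow s C))"

definition M_min :: "'a set \<Rightarrow> nat \<Rightarrow> nat \<Rightarrow> nat \<Rightarrow> nat \<Rightarrow> nat" where
  "M_min V r k t s = (MIN c\<in>colorings r (nsets V k). M_col V r k t s c)"

definition tight_rel :: "nat \<Rightarrow> 'a set set \<Rightarrow> ('a set \<times> 'a set) set" where
  "tight_rel t H = {(e, f). e \<in> H \<and> f \<in> H \<and> t \<le> card (e \<inter> f)}\<^sup>* \<inter> H \<times> H"

lemma equiv_tight_rel: "equiv H (tight_rel t H)"
proof -
  have "sym {(e, f). e \<in> H \<and> f \<in> H \<and> t \<le> card (e \<inter> f)}"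
    by (auto simp: sym_def Int_commute)
  then have "sym ({(e, f). e \<in> H \<and> f \<in> H \<and> t \<le> card (e \<inter> f)}\<^sup>*)"
    by (rule sym_rtrancl)
  then show ?thesis
    unfolding tight_rel_def
    by (intro equivI refl_onI symI transI) (auto dest: symD intro: rtrancl_trans)
qed

lemma merge_invariant:
  assumes "(merge_step t)\<^sup>*\<^sup>* ((\<lambda>e. {e}) ` H) P"
  shows "\<Union>P = H \<and> {} \<notin> P \<and> (\<forall>C\<in>P. C \<times> C \<subseteq> tight_rel t H)"
  using assms
proof (induction rule: rtranclp_induct)
  case base
  then show ?case by (auto simp: tight_rel_def)
next
  case (step P Q)
  from step.hyps obtain C D e f where
    CD: "C \<in> P" "D \<in> P" "e \<in> C" "f \<in> D" "t \<le> card (e \<inter> f)"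
      "Q = insert (C \<union> D) (P - {C, D})"
    unfolding merge_step_def by auto
  have P: "\<Union>P = H" "{} \<notin> P" "\<And>C. C \<in> P \<Longrightarrow> C \<times> C \<subseteq> tight_rel t H"
    using step.IH by auto
  have E: "sym (tight_rel t H)" "trans (tight_rel t H)"
    using equiv_tight_rel[of H t] by (auto simp: equiv_def)
  have ef: "(e, f) \<in> tight_rel t H" "(f, e) \<in> tight_rel t H"
    using CD P(1) E(1) by (auto simp: tight_rel_def dest: symD)
  have "\<Union>Q = H" "{} \<notin> Q" using CD P(1,2) by auto
  moreover have "(x, y) \<in> tight_rel t H" if "x \<in> C \<union> D" "y \<in> C \<union> D" for x y
  proof -
    have "(x, e) \<in> tight_rel t H" "(e, y) \<in> tight_rel t H"
      using that P(3)[OF CD(1)] P(3)[OF CD(2)] CD(3,4) ef E(2) by (blast dest: transD)+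
    then show ?thesis using E(2) by (blast dest: transD)
  qed
  ultimately show ?case using P(3) CD(6) by blast
qed

lemma merge_final:
  assumes "(merge_step t)\<^sup>*\<^sup>* ((\<lambda>e. {e}) ` H) P" "\<nexists>Q. merge_step t P Q"
  shows "P = H // tight_rel t H"
proof -
  let ?R = "tight_rel t H"
  have P: "\<Union>P = H" "{} \<notin> P" "\<And>C. C \<in> P \<Longrightarrow> C \<times> C \<subseteq> ?R"
    using merge_invariant[OF assms(1)] by auto
  have closed: "f \<in> C" if "C \<in> P" "e \<in> C" "(e, f) \<in> ?R" for C e f
  proof -
    have "(e, f) \<in> {(e, f). e \<in> H \<and> f \<in> H \<and> t \<le> card (e \<inter> f)}\<^sup>*"
      using that(3) by (simp add: tight_rel_def)
    then show ?thesis
    proof (induction rule: rtrancl_induct)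
      case base
      show ?case by fact
    next
      case (step y z)
      from step.hyps P(1) obtain D where D: "D \<in> P" "z \<in> D" by auto
      have "C = D"
        using assms(2) that(1) D step.IH step.hyps(2) unfolding merge_step_def by blast
      then show ?case using D by simp
    qed
  qed
  have class_eq: "C = ?R `` {e}" if "C \<in> P" "e \<in> C" for C e
    using closed[OF that] P(3)[OF that(1)] that(2) by blast
  show ?thesis
  proof (intro equalityI subsetI)
    fix C assume C: "C \<in> P"
    then obtain e where "e \<in> C" using P(2) by (metis ex_in_conv)
    then show "C \<in> H // ?R" using C class_eq P(1) by (metis UnionI quotientI)
  next
    fix C assume "C \<in> H // ?R"
    then obtain e where e: "e \<in> H" "C = ?R `` {e}" by (auto elim: quotientE)
    then obtain D where "D \<in> P" "e \<in> D" using P(1) by auto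
    then show "C \<in> P" using class_eq e(2) by simp
  qed
qed

lemma merge_terminates:
  assumes "finite P"
  shows "\<exists>Q. (merge_step t)\<^sup>*\<^sup>* P Q \<and> (\<nexists>R. merge_step t Q R)"
  using assms
proof (induction "card P" arbitrary: P rule: less_induct)
  case less
  show ?case
  proof (cases "\<exists>R. merge_step t P R")
    case False
    then show ?thesis by blast
  next
    case True
    then obtain R where R: "merge_step t P R" by blast
    then obtain C D where CD: "C \<in> P" "D \<in> P" "C \<noteq> D" "R = insert (C \<union> D) (P - {C, D})"
      unfolding merge_step_def by blast
    have "finite R" using CD less.prems by simp
    have "card {C, D} \<le> card P" using CD less.prems by (intro card_mono) auto
    then have "card R < card P"
      using CD less.prems card_insert_le_m1[of "card P - 1" "P - {C, D}" "C \<union> D"]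
      by (simp add: card_Diff_subset)
    from less.hyps[OF this \<open>finite R\<close>] R show ?thesis
      by (meson converse_rtranclp_into_rtranclp)
  qed
qed

lemma tight_components_unique:
  assumes "finite H"
  shows "\<exists>!P. (merge_step t)\<^sup>*\<^sup>* ((\<lambda>e. {e}) ` H) P \<and> (\<nexists>Q. merge_step t P Q)"
  using merge_terminates[of "(\<lambda>e. {e}) ` H" t] merge_final[of t H] assms by (metis finite_imageI)

lemma tight_components_eq_quotient:
  assumes "finite H"
  shows "tight_components t H = H // tight_rel t H"
  using theI'[OF tight_components_unique[OF assms, of t]] merge_final
  unfolding tight_components_def by blast

end

theory Submission
  imports Defs
begin

text \<open>
  Put \<open>m = max t s\<close>. Two edges of one colour that contain a common \<open>m\<close>-set lie in the same
  \<open>t\<close>-tight component, so for each colour an \<open>m\<close>-set is covered by at most one component of that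
  colour. Fix a set \<open>X\<close> of size \<open>h\<close> with \<open>2 * m - h \<le> k\<close> and regard the \<open>m\<close>-sets that
  contain \<open>X\<close> as the vertices of a complete graph. Any two of them lie in a common edge of the
  hypergraph, whose colour is given to the pair. A 2-coloured complete graph is connected in one
  of its colours, which means that a single monochromatic component covers all \<open>m\<close>-sets that
  contain \<open>X\<close> (lemma \<open>component_covers_link\<close>).

  For \<open>2 * m \<le> k\<close> take \<open>X = {}\<close>: the component covers all \<open>m\<close>-sets, hence all \<open>s\<close>-sets,
  which is part (a).

  For \<open>3 * m \<le> 2 * k\<close> take \<open>h = m div 2\<close>, and say that an
  \<open>h\<close>-set is served by the colour and the component just found for it. Two
  \<open>h\<close>-sets lie in a common \<open>m\<close>-set, so all \<open>h\<close>-sets that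
  are served by colour \<open>i\<close> are served by the same component \<open>R i\<close>
  (lemma \<open>dominant_component\<close>). If an edge \<open>e\<close> of one colour is
  outside the component chosen for that colour, then every \<open>h\<close>-subset of
  \<open>e\<close> must be served by the other colour, and so every \<open>m\<close>-subset of
  \<open>e\<close> is covered by the other chosen component. Switching the colour of all such
  edges attaches them to that component and adds nothing to its \<open>s\<close>-shadow (lemma
  \<open>absorb_edges\<close>). Hence any colouring can be changed into one in which each colour
  is \<open>t\<close>-tightly connected, without increasing the largest shadow; applied to an
  optimal colouring this gives part (b).
\<close>

section \<open>Tight components\<close>

lemma component_subset:
  assumes "finite H" "C \<in> tight_components t H"
  shows "C \<subseteq> H" "C \<noteq> {}"
proof -
  have "C \<in> H // tight_rel t H"
    using assms by (simp add: tight_components_eq_quotient)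
  then show "C \<subseteq> H" "C \<noteq> {}"
    using equiv_tight_rel[of H t] in_quotient_imp_subset in_quotient_imp_non_empty by metis+
qed

lemma finite_tight_components:
  assumes "finite H"
  shows "finite (tight_components t H)"
  by (rule finite_subset[of _ "Pow H"]) (use component_subset(1)[OF assms] assms in auto)

lemma component_closed:
  assumes "finite H" "C \<in> tight_components t H" "e \<in> C" "f \<in> H" "t \<le> card (e \<inter> f)"
  shows "f \<in> C"
proof -
  have "C \<in> H // tight_rel t H"
    using assms by (simp add: tight_components_eq_quotient)
  moreover have "(e, f) \<in> tight_rel t H"
    using component_subset[OF assms(1,2)] assms by (auto simp: tight_rel_def)
  ultimately show ?thesis
    using in_quotient_imp_closed[OF equiv_tight_rel] assms(3) by metis
qed

lemma exists_component:
  assumes "finite H" "e \<in> H"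
  shows "\<exists>C\<in>tight_components t H. e \<in> C"
proof
  show "tight_rel t H `` {e} \<in> tight_components t H"
    using assms by (simp add: tight_components_eq_quotient quotientI)
  show "e \<in> tight_rel t H `` {e}"
    using assms(2) equiv_class_self[OF equiv_tight_rel] by metis
qed

text \<open>The connecting sequences of a component never leave it, so the component is connected as a
  hypergraph of its own.\<close>

lemma component_connected:
  assumes "finite H" "C \<in> tight_components t H"
  shows "C \<times> C \<subseteq> tight_rel t C"
proof clarify
  fix e f assume ef: "e \<in> C" "f \<in> C"
  have "C \<in> H // tight_rel t H"
    using assms by (simp add: tight_components_eq_quotient)
  then have "(e, f) \<in> tight_rel t H"
    using quotient_eq_iff[OF equiv_tight_rel] ef by metis
  then have "(e, f) \<in> {(e, f). e \<in> H \<and> f \<in> H \<and> t \<le> card (e \<inter> f)}\<^sup>*"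
    by (simp add: tight_rel_def)
  then have "f \<in> C \<and> (e, f) \<in> tight_rel t C"
  proof (induction rule: rtrancl_induct)
    case base
    then show ?case using ef by (auto simp: tight_rel_def)
  next
    case (step y z)
    then have z: "z \<in> C"
      using component_closed[OF assms] by blast
    then have "(y, z) \<in> tight_rel t C"
      using step by (auto simp: tight_rel_def)
    then show ?case
      using z step.IH equiv_tight_rel[of C t] by (meson equivE transD)
  qed
  then show "(e, f) \<in> tight_rel t C" ..
qed

lemma components_of_connected:
  assumes "finite H" "H \<noteq> {}" "H \<times> H \<subseteq> tight_rel t H"
  shows "tight_components t H = {H}"
proof -
  have "tight_rel t H = H \<times> H"
    using assms(3) by (auto simp: tight_rel_def)
  then show ?thesis
    using assms(1,2) by (auto simp: tight_components_eq_quotient quotient_def)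
qed

lemma shadow_overlap:
  assumes "T \<subseteq> e" "T \<subseteq> f" "finite e" "card T = m" "t \<le> m"
  shows "t \<le> card (e \<inter> f)"
  using card_mono[of "e \<inter> f" T] assms by simp

lemma component_of_shadow_unique:
  assumes "finite H" "\<And>e. e \<in> H \<Longrightarrow> finite e" "t \<le> m"
    and "C \<in> tight_components t H" "D \<in> tight_components t H"
    and "T \<in> shadow m C" "T \<in> shadow m D"
  shows "C = D"
proof -
  obtain e f where e: "e \<in> C" "T \<subseteq> e" and f: "f \<in> D" "T \<subseteq> f" and T: "card T = m"
    using assms(6,7) by (auto simp: shadow_def)
  have "t \<le> card (e \<inter> f)"
    using shadow_overlap e f T assms component_subset(1)[OF assms(1,4)] by (metis subsetD)
  then have "f \<in> C"
    using component_closed[OF assms(1,4) e(1)] f(1) component_subset(1)[OF assms(1,5)] by blast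
  then show ?thesis
    using f(1) assms(1,4,5) quotient_disj[OF equiv_tight_rel]
    by (metis tight_components_eq_quotient disjoint_iff)
qed

section \<open>Absorbing edges into a connected hypergraph\<close>

text \<open>Every added edge shares an \<open>m\<close>-set with an edge of \<open>R\<close>, which joins it to \<open>R\<close> since
  \<open>t \<le> m\<close>; its \<open>s\<close>-subsets extend to \<open>m\<close>-subsets, which are already covered.\<close>

lemma absorb_edges:
  assumes conn: "R \<times> R \<subseteq> tight_rel t R" and m: "t \<le> m" "s \<le> m" "m \<le> k"
    and N: "\<And>e. e \<in> N \<Longrightarrow> finite e \<and> card e = k"
    and covered: "\<And>e T. \<lbrakk>e \<in> N; T \<subseteq> e; card T = m\<rbrakk> \<Longrightarrow> T \<in> shadow m R"
  shows "(R \<union> N) \<times> (R \<union> N) \<subseteq> tight_rel t (R \<union> N)"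
    and "shadow s (R \<union> N) = shadow s R"
proof -
  let ?E = "tight_rel t (R \<union> N)"
  have sym: "sym ?E" and trans: "trans ?E"
    using equiv_tight_rel[of "R \<union> N" t] by (auto elim: equivE)
  have RR: "(e, f) \<in> ?E" if "e \<in> R" "f \<in> R" for e f
  proof -
    have "(e, f) \<in> {(e, f). e \<in> R \<and> f \<in> R \<and> t \<le> card (e \<inter> f)}\<^sup>*"
      using that conn by (auto simp: tight_rel_def)
    then have "(e, f) \<in> {(e, f). e \<in> R \<union> N \<and> f \<in> R \<union> N \<and> t \<le> card (e \<inter> f)}\<^sup>*"
      by (rule rtrancl_mono[THEN subsetD, rotated]) auto
    then show ?thesis
      using that by (simp add: tight_rel_def)
  qed
  have attach: "\<exists>f\<in>R. (e, f) \<in> ?E" if e: "e \<in> R \<union> N" for e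
  proof (cases "e \<in> R")
    case True
    then show ?thesis using RR by blast
  next
    case False
    then have eN: "e \<in> N" using e by blast
    obtain T where T: "T \<subseteq> e" "card T = m"
      using obtain_subset_with_card_n[of m e] m(3) N[OF eN] by metis
    obtain f where f: "f \<in> R" "T \<subseteq> f"
      using covered[OF eN T] by (auto simp: shadow_def)
    have "t \<le> card (e \<inter> f)"
      using shadow_overlap T f(2) N[OF eN] m(1) by metis
    then have "(e, f) \<in> ?E"
      using eN f(1) by (auto simp: tight_rel_def)
    then show ?thesis using f(1) by blast
  qed
  show "(R \<union> N) \<times> (R \<union> N) \<subseteq> ?E"
  proof clarify
    fix x y assume "x \<in> R \<union> N" "y \<in> R \<union> N"
    then obtain f g where "f \<in> R" "(x, f) \<in> ?E" "g \<in> R" "(y, g) \<in> ?E"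
      using attach by meson
    then show "(x, y) \<in> ?E"
      using RR sym trans by (meson symD transD)
  qed
  have "S \<in> shadow s R" if S: "S \<subseteq> e" "card S = s" "e \<in> N" for S e
  proof -
    obtain T where T: "S \<subseteq> T" "T \<subseteq> e" "card T = m"
      using exists_subset_between[of S m e] S m N[OF S(3)] by metis
    show ?thesis
      using covered[OF S(3) T(2,3)] T(1) S(2) by (auto simp: shadow_def)
  qed
  then show "shadow s (R \<union> N) = shadow s R"
    by (auto simp: shadow_def)
qed

section \<open>Links in a two-coloured complete hypergraph\<close>

lemma color_class_finite:
  "finite V \<Longrightarrow> finite (color_class V k c i)"
  by (simp add: color_class_def finite_imp_finite_nsets)

lemma color_class_edge:
  "e \<in> color_class V k c i \<Longrightarrow> finite e \<and> card e = k \<and> e \<subseteq> V"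
  by (auto simp: color_class_def nsets_def)

text \<open>This is the fact that a 2-coloured complete graph is connected in one of its colours:
  \<open>P\<close> and \<open>Q\<close> stand for being joined by a path of the respective colour.\<close>

lemma two_relations_cover:
  assumes "\<And>x y. P x y \<Longrightarrow> P y x" "\<And>x y z. \<lbrakk>P x y; P y z\<rbrakk> \<Longrightarrow> P x z"
    and "\<And>x y. Q x y \<Longrightarrow> Q y x" "\<And>x y z. \<lbrakk>Q x y; Q y z\<rbrakk> \<Longrightarrow> Q x z"
    and "\<And>x y. \<lbrakk>x \<in> A; y \<in> A\<rbrakk> \<Longrightarrow> P x y \<or> Q x y"
  shows "(\<forall>x\<in>A. \<forall>y\<in>A. P x y) \<or> (\<forall>x\<in>A. \<forall>y\<in>A. Q x y)"
proof (rule ccontr)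
  assume "\<not> ?thesis"
  then obtain a b c d where "a \<in> A" "b \<in> A" "\<not> P a b" "c \<in> A" "d \<in> A" "\<not> Q c d"
    by blast
  then show False
    using assms by metis
qed

text \<open>Being covered by a common component of a given colour is an equivalence relation on the covered
  \<open>m\<close>-sets, because components of one colour cover disjoint families of \<open>m\<close>-sets. Two \<open>m\<close>-sets
  that contain \<open>X\<close> have a union of at most \<open>2 * m - card X \<le> k\<close> elements, so an edge covers both.\<close>

lemma component_covers_link:
  assumes V: "finite V" "k \<le> card V" and c: "c \<in> colorings 2 (nsets V k)"
    and m: "t \<le> m" "m \<le> k" and X: "X \<subseteq> V" "card X \<le> m" "2 * m \<le> k + card X"
  shows "\<exists>i\<in>{1..2}. \<exists>C\<in>tight_components t (color_class V k c i).
           \<forall>T\<in>nsets V m. X \<subseteq> T \<longrightarrow> T \<in> shadow m C"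
proof -
  let ?H = "color_class V k c"
  define A where "A = {T \<in> nsets V m. X \<subseteq> T}"
  define P where
    "P i T U \<longleftrightarrow> (\<exists>C\<in>tight_components t (?H i). T \<in> shadow m C \<and> U \<in> shadow m C)" for i T U
  have unique: "C = D" if "C \<in> tight_components t (?H i)" "D \<in> tight_components t (?H i)"
    "T \<in> shadow m C" "T \<in> shadow m D" for i C D T
    using component_of_shadow_unique[of "?H i" t m C D T] that color_class_finite[OF V(1)]
      color_class_edge m(1) by metis
  have P_sym: "P i U T" if "P i T U" for i T U
    using that by (auto simp: P_def)
  have P_trans: "P i T W" if "P i T U" "P i U W" for i T U W
    using that unique unfolding P_def by metis
  have P_total: "P 1 T U \<or> P 2 T U" if TU: "T \<in> A" "U \<in> A" for T U
  proof -
    have TU': "finite T" "finite U" "card T = m" "card U = m" "T \<subseteq> V" "U \<subseteq> V" "X \<subseteq> T \<inter> U"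
      using TU by (auto simp: A_def nsets_def)
    then have "card X \<le> card (T \<inter> U)"
      by (intro card_mono) auto
    then have "card (T \<union> U) \<le> k"
      using card_Un_Int[of T U] TU' X(3) by linarith
    then obtain e where e: "T \<union> U \<subseteq> e" "e \<subseteq> V" "card e = k"
      using exists_subset_between[of "T \<union> U" k V] V TU' by auto
    then have eV: "e \<in> nsets V k"
      using V(1) by (auto simp: nsets_def intro: finite_subset)
    then have "c e = 1 \<or> c e = 2"
      using c by (force simp: colorings_def)
    then obtain i where i: "i = 1 \<or> i = 2" "e \<in> ?H i"
      using eV by (auto simp: color_class_def)
    then obtain C where "C \<in> tight_components t (?H i)" "e \<in> C"
      using exists_component color_class_finite[OF V(1)] by metis
    then have "P i T U"
      using e(1) TU' by (auto simp: P_def shadow_def)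
    then show ?thesis using i(1) by auto
  qed
  have "(\<forall>T\<in>A. \<forall>U\<in>A. P 1 T U) \<or> (\<forall>T\<in>A. \<forall>U\<in>A. P 2 T U)"
    by (rule two_relations_cover) (fact P_sym P_trans P_total)+
  moreover have "1 \<in> {1..2::nat}" "2 \<in> {1..2::nat}"
    by simp_all
  ultimately obtain i where i: "i \<in> {1..2}" "\<And>T U. \<lbrakk>T \<in> A; U \<in> A\<rbrakk> \<Longrightarrow> P i T U"
    by blast
  obtain T\<^sub>0 where T\<^sub>0: "T\<^sub>0 \<in> A"
  proof -
    obtain T where "X \<subseteq> T" "T \<subseteq> V" "card T = m"
      using exists_subset_between[of X m V] X V m(2) by auto
    then show ?thesis
      using that V(1) by (auto simp: A_def nsets_def intro: finite_subset)
  qed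
  obtain C where C: "C \<in> tight_components t (?H i)" "T\<^sub>0 \<in> shadow m C"
    using i(2)[OF T\<^sub>0 T\<^sub>0] by (auto simp: P_def)
  have "T \<in> shadow m C" if "T \<in> A" for T
    using i(2)[OF T\<^sub>0 that] unique C unfolding P_def by metis
  then show ?thesis
    using i(1) C(1) unfolding A_def by blast
qed

text \<open>Two \<open>h\<close>-sets lie in a common \<open>m\<close>-set, so components of one colour that cover the links of
  these \<open>h\<close>-sets share a covered \<open>m\<close>-set and coincide. The empty hypergraph stands in when no component of
  colour \<open>i\<close> covers the link of an \<open>h\<close>-set.\<close>

lemma dominant_component:
  assumes V: "finite V" "m \<le> card V" and m: "t \<le> m" "2 * h \<le> m"
  shows "\<exists>R\<in>insert {} (tight_components t (color_class V k c i)).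
           \<forall>X\<in>nsets V h. (\<exists>C\<in>tight_components t (color_class V k c i).
               \<forall>T\<in>nsets V m. X \<subseteq> T \<longrightarrow> T \<in> shadow m C) \<longrightarrow>
             (\<forall>T\<in>nsets V m. X \<subseteq> T \<longrightarrow> T \<in> shadow m R)"
proof -
  let ?H = "color_class V k c i"
  define served where "served X C \<longleftrightarrow> (\<forall>T\<in>nsets V m. X \<subseteq> T \<longrightarrow> T \<in> shadow m C)" for X C
  have same: "C = D" if CD: "C \<in> tight_components t ?H" "D \<in> tight_components t ?H"
      "served X C" "served Y D" and XY: "X \<in> nsets V h" "Y \<in> nsets V h" for C D X Y
  proof -
    have "card (X \<union> Y) \<le> m"
      using card_Un_le[of X Y] XY m(2) by (auto simp: nsets_def)
    then obtain T where T: "X \<union> Y \<subseteq> T" "T \<subseteq> V" "card T = m"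
      using exists_subset_between[of "X \<union> Y" m V] V XY by (auto simp: nsets_def)
    then have "T \<in> shadow m C" "T \<in> shadow m D"
      using CD(3,4) V(1) by (auto simp: served_def nsets_def intro: finite_subset)
    then show ?thesis
      using component_of_shadow_unique[of ?H t m C D T] CD(1,2) color_class_finite[OF V(1)]
        color_class_edge m(1) by metis
  qed
  show ?thesis
  proof (cases "\<exists>X\<in>nsets V h. \<exists>C\<in>tight_components t ?H. served X C")
    case True
    then obtain X C where "X \<in> nsets V h" "C \<in> tight_components t ?H" "served X C"
      by blast
    then show ?thesis
      using same unfolding served_def[symmetric] by (intro bexI[of _ C]) blast+
  next
    case False
    then show ?thesis
      unfolding served_def[symmetric] by blast
  qed
qed

section \<open>Extremal values over colourings\<close>

lemma card_shadow_le_M_col: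
  assumes "finite V" "i \<in> {1..r}" "C \<in> tight_components t (color_class V k c i)"
  shows "card (shadow s C) \<le> M_col V r k t s c"
proof -
  have fin: "finite (tight_components t (color_class V k c j))" for j
    by (intro finite_tight_components color_class_finite assms(1))
  have "color_class V k c i \<noteq> {}"
    using component_subset[OF color_class_finite[OF assms(1)] assms(3)] by blast
  moreover have "card (shadow s C) \<le>
      (MAX C\<in>tight_components t (color_class V k c i). card (shadow s C))"
    using fin assms(3) by (intro Max_ge) auto
  ultimately show ?thesis
    unfolding M_col_def using assms(2) by (intro Max_ge_iff[THEN iffD2]) auto
qed

lemma M_col_le:
  assumes "finite V" "k \<le> card V" "c \<in> colorings r (nsets V k)"
    and bound: "\<And>i C. \<lbrakk>i \<in> {1..r}; C \<in> tight_components t (color_class V k c i)\<rbrakk>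
                  \<Longrightarrow> card (shadow s C) \<le> b"
  shows "M_col V r k t s c \<le> b"
proof -
  obtain e where e: "e \<in> nsets V k"
    using obtain_subset_with_card_n[OF assms(2)] assms(1)
    by (auto simp: nsets_def intro: finite_subset)
  then have "c e \<in> {1..r}" "e \<in> color_class V k c (c e)"
    using assms(3) by (auto simp: colorings_def color_class_def)
  then have nonempty: "{i \<in> {1..r}. color_class V k c i \<noteq> {}} \<noteq> {}"
    by blast
  have "(MAX C\<in>tight_components t (color_class V k c i). card (shadow s C)) \<le> b"
    if i: "i \<in> {1..r}" "color_class V k c i \<noteq> {}" for i
  proof (rule Max.boundedI)
    show "finite ((\<lambda>C. card (shadow s C)) ` tight_components t (color_class V k c i))"
      by (intro finite_imageI finite_tight_components color_class_finite assms(1))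
    show "(\<lambda>C. card (shadow s C)) ` tight_components t (color_class V k c i) \<noteq> {}"
      using exists_component[OF color_class_finite[OF assms(1)]] i(2) by blast
  qed (use bound i(1) in auto)
  then show ?thesis
    unfolding M_col_def using nonempty by (intro Max.boundedI) auto
qed

lemma finite_colorings: "finite V \<Longrightarrow> finite (colorings r (nsets V k))"
  by (simp add: colorings_def finite_PiE finite_imp_finite_nsets)

lemma colorings_nonempty: "0 < r \<Longrightarrow> colorings r (nsets V k) \<noteq> {}"
  by (auto simp: colorings_def PiE_eq_empty_iff)

lemma M_min_le:
  "finite V \<Longrightarrow> c \<in> colorings r (nsets V k) \<Longrightarrow> M_min V r k t s \<le> M_col V r k t s c"
  unfolding M_min_def by (intro Min_le) (auto simp: finite_colorings)

lemma M_min_attained: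
  assumes "finite V" "0 < r"
  shows "\<exists>c\<in>colorings r (nsets V k). M_col V r k t s c = M_min V r k t s"
proof -
  have "M_min V r k t s \<in> M_col V r k t s ` colorings r (nsets V k)"
    unfolding M_min_def using finite_colorings[OF assms(1)] colorings_nonempty[OF assms(2)]
    by (intro Min_in) simp_all
  then show ?thesis by auto
qed

lemma shadow_subset_nsets:
  assumes "C \<subseteq> nsets V k"
  shows "shadow s C \<subseteq> nsets V s"
proof
  fix S assume "S \<in> shadow s C"
  then obtain e where e: "e \<in> C" "S \<subseteq> e" "card S = s"
    by (auto simp: shadow_def)
  then have "e \<subseteq> V" "finite e"
    using assms by (auto simp: nsets_def)
  then show "S \<in> nsets V s"
    using e by (auto simp: nsets_def intro: finite_subset)
qed

lemma shadow_complete: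
  assumes "finite V" "s \<le> k" "k \<le> card V"
  shows "shadow s (nsets V k) = nsets V s"
proof (intro equalityI shadow_subset_nsets subset_refl subsetI)
  fix S assume S: "S \<in> nsets V s"
  then obtain e where "S \<subseteq> e" "e \<subseteq> V" "card e = k"
    using exists_subset_between[of S k V] assms by (auto simp: nsets_def)
  then show "S \<in> shadow s (nsets V k)"
    using S assms(1) by (auto simp: shadow_def nsets_def intro: finite_subset)
qed

section \<open>The two parts\<close>

lemma spanning_monochromatic_component:
  assumes V: "finite V" "k \<le> card V" and c: "c \<in> colorings 2 (nsets V k)"
    and le: "2 * max t s \<le> k"
  shows "\<exists>i\<in>{1..2}. \<exists>C\<in>tight_components t (color_class V k c i). shadow s C = nsets V s"
proof -
  define m where "m = max t s"
  have m: "t \<le> m" "m \<le> k" "s \<le> m"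
    using le by (auto simp: m_def)
  obtain i C where iC: "i \<in> {1..2}" "C \<in> tight_components t (color_class V k c i)"
      "\<And>T. T \<in> nsets V m \<Longrightarrow> T \<in> shadow m C"
    using component_covers_link[OF V c m(1,2), of "{}"] le unfolding m_def by fastforce
  have "S \<in> shadow s C" if S: "S \<in> nsets V s" for S
  proof -
    obtain T where T: "S \<subseteq> T" "T \<subseteq> V" "card T = m"
      using exists_subset_between[of S m V] S V m by (auto simp: nsets_def)
    then have "T \<in> shadow m C"
      using iC(3) V(1) by (auto simp: nsets_def intro: finite_subset)
    then show ?thesis
      using T(1) S by (auto simp: shadow_def nsets_def)
  qed
  moreover have "C \<subseteq> nsets V k"
    using component_subset[OF color_class_finite[OF V(1)] iC(2)] by (auto simp: color_class_def)
  ultimately show ?thesis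
    using iC(1,2) shadow_subset_nsets[of C V k s] by blast
qed

lemma M_min_eq_binomial:
  assumes V: "finite V" "k \<le> card V" and le: "2 * max t s \<le> k"
  shows "M_min V 2 k t s = card V choose s"
proof -
  obtain c where c: "c \<in> colorings 2 (nsets V k)" "M_col V 2 k t s c = M_min V 2 k t s"
    using M_min_attained[OF V(1) zero_less_numeral] by blast
  obtain i C where iC: "i \<in> {1..2}" "C \<in> tight_components t (color_class V k c i)"
      "shadow s C = nsets V s"
    using spanning_monochromatic_component[OF V c(1) le] by blast
  have "card V choose s \<le> M_col V 2 k t s c"
    using card_shadow_le_M_col[OF V(1) iC(1,2), of s] iC(3) by (simp add: card_nsets)
  moreover have "M_col V 2 k t s c \<le> card V choose s"
  proof (rule M_col_le[OF V c(1)])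
    fix j D assume "D \<in> tight_components t (color_class V k c j)"
    then have "D \<subseteq> nsets V k"
      using component_subset[OF color_class_finite[OF V(1)]] by (fastforce simp: color_class_def)
    then have "card (shadow s D) \<le> card (nsets V s)"
      using V(1) by (intro card_mono shadow_subset_nsets finite_imp_finite_nsets)
    then show "card (shadow s D) \<le> card V choose s"
      by (simp add: card_nsets)
  qed
  ultimately show ?thesis using c(2) by simp
qed

text \<open>The new colouring \<open>d\<close> keeps the colour of the edges in \<open>R 1\<close> and \<open>R 2\<close>, the components
  given by \<open>dominant_component\<close>, and switches all other edges. An empty \<open>R i\<close> is harmless: it covers
  nothing, so it absorbs nothing, and colour \<open>i\<close> disappears.\<close>

lemma connect_color_classes:
  assumes V: "finite V" "k \<le> card V" and c: "c \<in> colorings 2 (nsets V k)"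
    and le: "3 * max t s \<le> 2 * k"
  shows "\<exists>d\<in>colorings 2 (nsets V k). M_col V 2 k t s d \<le> M_col V 2 k t s c \<and>
           (\<forall>i\<in>{1..2}. color_class V k d i \<noteq> {} \<longrightarrow>
              tight_components t (color_class V k d i) = {color_class V k d i})"
proof -
  define m where "m = max t s"
  define h where "h = m div 2"
  let ?H = "color_class V k c"
  have m: "t \<le> m" "s \<le> m" "m \<le> k" "m \<le> card V" and h: "2 * h \<le> m" "h \<le> m" "2 * m \<le> k + h"
    using le V(2) by (auto simp: m_def h_def)
  obtain R where R: "\<And>i. R i \<in> insert {} (tight_components t (?H i))"
    and R_serves: "\<And>i X C T. \<lbrakk>X \<in> nsets V h; C \<in> tight_components t (?H i);
        \<forall>T\<in>nsets V m. X \<subseteq> T \<longrightarrow> T \<in> shadow m C; T \<in> nsets V m; X \<subseteq> T\<rbrakk> \<Longrightarrow> T \<in> shadow m (R i)"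
    using dominant_component[OF V(1) m(4,1) h(1), where k = k and c = c] by metis
  have R_sub: "R i \<subseteq> ?H i" for i
    using R[of i] component_subset[OF color_class_finite[OF V(1)]] by blast
  have R_conn: "R i \<times> R i \<subseteq> tight_rel t (R i)" for i
    using R[of i] component_connected[OF color_class_finite[OF V(1)]] by blast
  have covered: "T \<in> shadow m (R i)"
    if ij: "{i, j} = {1, 2}" and e: "e \<in> ?H j - R j" and T: "T \<subseteq> e" "card T = m" for i j e T
  proof -
    have e': "finite e" "card e = k" "e \<subseteq> V"
      using e color_class_edge by blast+
    have TV: "T \<in> nsets V m"
      using T e' by (auto simp: nsets_def intro: finite_subset)
    obtain X where X: "X \<subseteq> T" "card X = h"
      using obtain_subset_with_card_n[of h T] T(2) h(2) by metis
    have XV: "X \<in> nsets V h"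
      using X TV by (auto simp: nsets_def intro: finite_subset)
    have "X \<subseteq> V" using X TV by (auto simp: nsets_def)
    then obtain l C where l: "l \<in> {1..2}" "C \<in> tight_components t (?H l)"
        "\<forall>T\<in>nsets V m. X \<subseteq> T \<longrightarrow> T \<in> shadow m C"
      using component_covers_link[OF V c m(1,3), of X] X(2) h by auto
    have T_l: "T \<in> shadow m (R l)"
      using R_serves[OF XV l(2,3) TV X(1)] .
    \<comment> \<open>Otherwise \<open>e\<close> would share \<open>T\<close> with an edge of the component \<open>R j\<close> of its own colour.\<close>
    have "l \<noteq> j"
    proof
      assume "l = j"
      then obtain f where f: "f \<in> R j" "T \<subseteq> f"
        using T_l by (auto simp: shadow_def)
      then have "finite f"
        using R_sub color_class_edge by blast
      then have "t \<le> card (f \<inter> e)"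
        using shadow_overlap f(2) T m(1) by metis
      moreover have "R j \<in> tight_components t (?H j)"
        using R[of j] f(1) by auto
      ultimately have "e \<in> R j"
        using component_closed[OF color_class_finite[OF V(1)]] f(1) e by blast
      then show False using e by blast
    qed
    then have "l = i"
      using l(1) ij by (auto simp: doubleton_eq_iff)
    then show ?thesis using T_l by simp
  qed
  define d where "d = (\<lambda>e\<in>nsets V k. if e \<in> R 1 \<union> (?H 2 - R 2) then 1 else 2::nat)"
  have d: "d \<in> colorings 2 (nsets V k)"
    by (auto simp: d_def colorings_def)
  have c12: "c e = 1 \<or> c e = 2" if "e \<in> nsets V k" for e
    using c that by (force simp: colorings_def)
  have d1: "color_class V k d 1 = R 1 \<union> (?H 2 - R 2)"
    using R_sub[of 1] by (auto simp: d_def color_class_def)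
  have d2: "color_class V k d 2 = R 2 \<union> (?H 1 - R 1)"
    using c12 R_sub[THEN subsetD] by (fastforce simp: d_def color_class_def)
  have new: "color_class V k d i \<times> color_class V k d i \<subseteq> tight_rel t (color_class V k d i)"
    "shadow s (color_class V k d i) = shadow s (R i)" if "i \<in> {1..2}" for i
  proof -
    have "i = 1 \<or> i = 2" using that by auto
    then obtain j where j: "{i, j} = {1, 2}" "color_class V k d i = R i \<union> (?H j - R j)"
    proof
      assume "i = 1"
      then show ?thesis using that[of 2] d1 by simp
    next
      assume "i = 2"
      then show ?thesis using that[of 1] d2 by (simp add: insert_commute)
    qed
    note absorb = absorb_edges[OF R_conn[of i] m(1-3), of "?H j - R j"]
    have edges: "finite e \<and> card e = k" if "e \<in> ?H j - R j" for e
      using that color_class_edge by blast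
    show "color_class V k d i \<times> color_class V k d i \<subseteq> tight_rel t (color_class V k d i)"
      unfolding j(2) by (rule absorb(1)) (fact edges covered[OF j(1)])+
    show "shadow s (color_class V k d i) = shadow s (R i)"
      unfolding j(2) by (rule absorb(2)) (fact edges covered[OF j(1)])+
  qed
  have comps: "tight_components t (color_class V k d i) = {color_class V k d i}"
    if "i \<in> {1..2}" "color_class V k d i \<noteq> {}" for i
    using components_of_connected[OF color_class_finite[OF V(1)] that(2) new(1)[OF that(1)]] .
  have "M_col V 2 k t s d \<le> M_col V 2 k t s c"
  proof (rule M_col_le[OF V d])
    fix i C assume i: "i \<in> {1..2::nat}" and C: "C \<in> tight_components t (color_class V k d i)"
    have "C = color_class V k d i"
      using comps[OF i] C component_subset[OF color_class_finite[OF V(1)] C] by auto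
    then have shadow: "shadow s C = shadow s (R i)"
      using new(2)[OF i] by simp
    show "card (shadow s C) \<le> M_col V 2 k t s c"
    proof (cases "R i = {}")
      case True
      show ?thesis unfolding shadow by (simp add: True shadow_def)
    next
      case False
      then show ?thesis
        using card_shadow_le_M_col[OF V(1) i, of "R i"] R[of i] shadow by auto
    qed
  qed
  then show ?thesis
    using d comps by blast
qed

theorem theorem1p4:
  fixes V :: "'a set" and n k t s :: nat
  assumes "finite V" and "card V = n"
    and "0 < n" and "0 < k" and "0 < t" and "0 < s"
    and "max (t + 1) s \<le> k" and "k \<le> n"
  shows "(2 * max t s \<le> k \<longrightarrow>
            M_min V 2 k t s = n choose s \<and>
            (\<forall>c\<in>colorings 2 (nsets V k).
               \<exists>i\<in>{1..2}. \<exists>C\<in>tight_components t (color_class V k c i).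
                 shadow s C = shadow s (nsets V k)))
       \<and> (3 * max t s \<le> 2 * k \<longrightarrow>
            (\<exists>c\<in>colorings 2 (nsets V k).
               M_col V 2 k t s c = M_min V 2 k t s \<and>
               (\<forall>i\<in>{1..2}. color_class V k c i \<noteq> {} \<longrightarrow>
                  (\<exists>C\<in>tight_components t (color_class V k c i). color_class V k c i \<subseteq> C))))"
proof (intro conjI impI)
  have V: "finite V" "k \<le> card V" and s: "s \<le> k"
    using assms by auto
  show "M_min V 2 k t s = n choose s" if "2 * max t s \<le> k"
    using M_min_eq_binomial[OF V that] assms(2) by simp
  show "\<forall>c\<in>colorings 2 (nsets V k).
          \<exists>i\<in>{1..2}. \<exists>C\<in>tight_components t (color_class V k c i).
            shadow s C = shadow s (nsets V k)" if "2 * max t s \<le> k"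
    using spanning_monochromatic_component[OF V _ that] shadow_complete[OF V(1) s V(2)] by simp
  show "\<exists>c\<in>colorings 2 (nsets V k).
          M_col V 2 k t s c = M_min V 2 k t s \<and>
          (\<forall>i\<in>{1..2}. color_class V k c i \<noteq> {} \<longrightarrow>
             (\<exists>C\<in>tight_components t (color_class V k c i). color_class V k c i \<subseteq> C))"
    if le: "3 * max t s \<le> 2 * k"
  proof -
    obtain c where c: "c \<in> colorings 2 (nsets V k)" "M_col V 2 k t s c = M_min V 2 k t s"
      using M_min_attained[OF V(1) zero_less_numeral] by blast
    obtain d where d: "d \<in> colorings 2 (nsets V k)" "M_col V 2 k t s d \<le> M_col V 2 k t s c"
        "\<forall>i\<in>{1..2}. color_class V k d i \<noteq> {} \<longrightarrow>
           tight_components t (color_class V k d i) = {color_class V k d i}"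
      using connect_color_classes[OF V c(1) le] by blast
    have "M_col V 2 k t s d = M_min V 2 k t s"
      using d(2) c(2) M_min_le[OF V(1) d(1)] by (metis order_antisym)
    then show ?thesis
      using d(1,3) by auto
  qed
qed

end
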